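(* There is an absolute constant $c>0$ such that for every $N>0$ there exists a terrain with at least one obstacle and with perimeter $P\ge N$ having the following property. Let $x$ be the largest perimeter of an obstacle of this terrain. For every rendezvous algorithm for labelled agents without a map and with possibly incoherent compasses, every integer $m\ge 1$ and every $\varepsilon>0$, there exist two distinct labels, the larger of which, $L$, satisfies $|L|\ge m$, and two starting positions at distance $D$ in the terrain with $0<D\le\varepsilon$, such that the cost of the algorithm executed by agents with these labels from these starting positions is at least $c\,(P+x|L|)$ (for a suitable choice by the adversary of compasses and walks).
   Context: A terrain is a planar set $\mathcal{P}_0\setminus(\mathcal{P}_1\cup\dots\cup\mathcal{P}_k)$, $k\ge 0$, where $\mathcal{P}_0$ is a closed polygon and $\mathcal{P}_1,\dots,\mathcal{P}_k$ (the obstacles) are disjoint open polygons included in $\mathcal{P}_0$; the boundary of the terrain belongs to it. The perimeter $P$ of the terrain is the sum of the perimeters of $\mathcal{P}_0,\mathcal{P}_1,\dots,\mathcal{P}_k$. The distance between two points of the terrain is the length of a shortest path between them included in the terrain. Agents: two agents, modeled as points, start at different points of the terrain chosen by the adversary. The terrain is a priori unknown to them (no map). Each has its own unit of length and a compass (a direction called North); both use the same clockwise orientation. Compasses are incoherent if the agents may have different Norths. An agent knows whether it is at an interior or a boundary point, and in the latter case the slope(s) of the boundary there; it cannot sense the terrain or the other agent in any vicinity of its location. The agents have distinct labels, which are positive integers; each agent uses its own label as a parameter of the common algorithm. For a label $\mu$, $|\mu|=\lfloor\log_2\mu\rfloor+1$ is the length of its binary representation. Routes: a deterministic algorithm makes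 an agent construct a finite polygonal path (its route) in steps. In a step starting at a point $v$, the agent chooses a direction $\alpha$ (according to its compass) and a distance; if the segment of this length in direction $\alpha$ from $v$ does not intersect the boundary, the step ends at the end of this segment, otherwise it ends at the closest boundary point encountered in direction $\alpha$. If $v$ is on a segment of the boundary, the agent may alternatively follow this segment in either direction until its end or for a given distance. The choices are a deterministic function of the agent's label and what it has learned so far. Walks: let the route be $(S_1,\dots,S_k)$ with $S_i=[a_i,a_{i+1}]$. The adversary chooses reals $0=t_1<t_2<\dots<t_{k+1}$ and continuous functions $f_i:[t_i,t_{i+1}]\to[a_i,a_{i+1}]$ with $f_i(t_i)=a_i$, $f_i(t_{i+1})=a_{i+1}$; the walk is $f(t)=f_i(t)$ for $t\in[t_i,t_{i+1}]$, and the agent is inert after $t_{k+1}$. Agents with walks $f_1,f_2$ meet (rendezvous) at time $t$ if $f_1(t)=f_2(t)$. A rendezvous algorithm is a deterministic algorithm guaranteeing that the agents meet regardless of the walks chosen by the adversary, for all terrains, starting positions, compasses and pairs of distinct labels. The trajectory of an agent is the sequence of segments of its route until rendezvous (the last one possibly being a portion of a route segment). The cost is the worst-case (over adversarial decisions) sum of the lengths of the segments of the trajectories of both agents. *)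

theory Defs
  imports "HOL-Analysis.Analysis" "HOL-Library.Extended_Nonnegative_Real"
begin

section \<open>Polygons and terrains\<close>

fun polygonal_path :: "complex list \<Rightarrow> real \<Rightarrow> complex" where
  "polygonal_path [] = linepath 0 0"
| "polygonal_path [a] = linepath a a"
| "polygonal_path [a, b] = linepath a b"
| "polygonal_path (a # b # c # ps) = linepath a b +++ polygonal_path (b # c # ps)"

definition chain_length :: "complex list \<Rightarrow> real" where
  "chain_length ps = (\<Sum>i<length ps - 1. dist (ps ! i) (ps ! Suc i))"

text \<open>A polygon is given by the cyclic list of its vertices. Straight angles are excluded, so that
  the sides are determined by the polygon as a planar set.\<close>

definition polygon_curve :: "complex list \<Rightarrow> complex set" where
  "polygon_curve vs = path_image (polygonal_path (vs @ [hd vs]))"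

definition polygon :: "complex list \<Rightarrow> bool" where
  "polygon vs \<longleftrightarrow>
     3 \<le> length vs \<and> simple_path (polygonal_path (vs @ [hd vs])) \<and>
     (\<forall>i < length vs. \<not> collinear {vs ! i, vs ! (Suc i mod length vs),
                                     vs ! (Suc (Suc i) mod length vs)})"

definition polygon_sides :: "complex list \<Rightarrow> (complex \<times> complex) set" where
  "polygon_sides vs = {(vs ! i, vs ! (Suc i mod length vs)) | i. i < length vs}"

definition open_polygon :: "complex list \<Rightarrow> complex set" where
  "open_polygon vs = inside (polygon_curve vs)"

definition closed_polygon :: "complex list \<Rightarrow> complex set" where
  "closed_polygon vs = polygon_curve vs \<union> inside (polygon_curve vs)"

definition perimeter :: "complex list \<Rightarrow> real" where
  "perimeter vs = chain_length (vs @ [hd vs])"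

record terrain =
  outer :: "complex list"
  obstacles :: "complex list list"

text \<open>Only the open obstacles are required to be disjoint and to lie in the closed outer polygon,
  so boundaries may touch.\<close>

definition terrain :: "terrain \<Rightarrow> bool" where
  "terrain T \<longleftrightarrow>
     polygon (outer T) \<and>
     (\<forall>Q \<in> set (obstacles T). polygon Q \<and> open_polygon Q \<subseteq> closed_polygon (outer T)) \<and>
     (\<forall>j < length (obstacles T). \<forall>i < j.
        open_polygon (obstacles T ! i) \<inter> open_polygon (obstacles T ! j) = {})"

definition region :: "terrain \<Rightarrow> complex set" where
  "region T = closed_polygon (outer T) - (\<Union>Q \<in> set (obstacles T). open_polygon Q)"

text \<open>The segments of the boundary of a terrain, in both orientations.\<close>

definition boundary_segments :: "terrain \<Rightarrow> (complex \<times> complex) set" where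
  "boundary_segments T =
     (let E = \<Union>Q \<in> set (outer T # obstacles T). polygon_sides Q in E \<union> E\<inverse>)"

definition total_perimeter :: "terrain \<Rightarrow> real" where
  "total_perimeter T = perimeter (outer T) + (\<Sum>Q \<leftarrow> obstacles T. perimeter Q)"

definition largest_obstacle_perimeter :: "terrain \<Rightarrow> real" where
  "largest_obstacle_perimeter T = Max (perimeter ` set (obstacles T))"

text \<open>The length of a path is the supremum of the lengths of its inscribed polygonal chains
  (\<open>\<infinity>\<close> for a path that is not rectifiable).\<close>

definition path_length :: "(real \<Rightarrow> complex) \<Rightarrow> ennreal" where
  "path_length g =
     (SUP ts \<in> {ts. sorted ts \<and> set ts \<subseteq> {0..1}}. ennreal (chain_length (map g ts)))"

definition terrain_dist :: "terrain \<Rightarrow> complex \<Rightarrow> complex \<Rightarrow> ennreal" where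
  "terrain_dist T p q =
     (INF g \<in> {g. path g \<and> path_image g \<subseteq> region T \<and> pathstart g = p \<and> pathfinish g = q}.
        path_length g)"


section \<open>Algorithms and routes\<close>

text \<open>Angles and distances in the types below are in the private coordinates of an agent: angles
  are relative to its own North (both agents turn them in the same sense), distances are multiples
  of its own unit of length.\<close>

datatype action =
    Stop
  | Go real real  \<comment> \<open>direction, distance\<close>
  | Follow real real  \<comment> \<open>direction along a boundary segment, distance\<close>
  | Follow_to_end real

text \<open>The slopes of the boundary are undirected, hence angles in \<open>[0, \<pi>)\<close>.\<close>

datatype sensing = Interior | Boundary "real set"

text \<open>What an agent has learned is the list, over the points reached so far (the starting point
  included), of its displacement from the starting point and of what it senses there. The previous
  actions need not be recorded, as they are determined by this list and by the label.\<close>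

type_synonym history = "(complex \<times> sensing) list"

type_synonym algorithm = "nat \<Rightarrow> history \<Rightarrow> action"

text \<open>A straight move from \<open>v\<close> ends after the given distance or at the first boundary point after
  \<open>v\<close>. It has length \<open>0\<close> if \<open>v\<close> is a boundary point from which the direction does not lead into the
  interior of the terrain.\<close>

definition go :: "terrain \<Rightarrow> complex \<Rightarrow> real \<Rightarrow> real \<Rightarrow> complex" where
  "go T v \<alpha> d =
     v + of_real (Sup {t. 0 \<le> t \<and> t \<le> max 0 d \<and>
                          (\<forall>s \<in> {0<..<t}. v + of_real s * cis \<alpha> \<in> interior (region T))}) * cis \<alpha>"

text \<open>The distances from \<open>v\<close> to the end, in direction \<open>\<alpha>\<close>, of the boundary segments that contain
  \<open>v\<close> and have this direction. There is more than one such segment only if the boundaries of two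
  polygons overlap; then the agent stops at the nearest end. If there is none, it stays at \<open>v\<close>.\<close>

definition end_distances :: "terrain \<Rightarrow> complex \<Rightarrow> real \<Rightarrow> real set" where
  "end_distances T v \<alpha> =
     {t. 0 < t \<and> (\<exists>(a, b) \<in> boundary_segments T.
                     v \<in> closed_segment a b \<and> b = v + of_real t * cis \<alpha>)}"

definition follow_to_end :: "terrain \<Rightarrow> complex \<Rightarrow> real \<Rightarrow> complex" where
  "follow_to_end T v \<alpha> =
     (if end_distances T v \<alpha> = {} then v else v + of_real (Min (end_distances T v \<alpha>)) * cis \<alpha>)"

definition follow :: "terrain \<Rightarrow> complex \<Rightarrow> real \<Rightarrow> real \<Rightarrow> complex" where
  "follow T v \<alpha> d =
     (if end_distances T v \<alpha> = {} then v
      else v + of_real (min (max 0 d) (Min (end_distances T v \<alpha>))) * cis \<alpha>)"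

text \<open>From here on, \<open>r\<close> is the unit of length of the agent and \<open>\<omega>\<close> the angle of its North.\<close>

fun step :: "terrain \<Rightarrow> real \<Rightarrow> real \<Rightarrow> complex \<Rightarrow> action \<Rightarrow> complex" where
  "step T r \<omega> v Stop = v"
| "step T r \<omega> v (Go \<alpha> d) = go T v (\<alpha> + \<omega>) (r * d)"
| "step T r \<omega> v (Follow \<alpha> d) = follow T v (\<alpha> + \<omega>) (r * d)"
| "step T r \<omega> v (Follow_to_end \<alpha>) = follow_to_end T v (\<alpha> + \<omega>)"

definition slopes :: "terrain \<Rightarrow> real \<Rightarrow> complex \<Rightarrow> real set" where
  "slopes T \<omega> v =
     {\<alpha> \<in> {0..<pi}. \<exists>(a, b) \<in> boundary_segments T.
        v \<in> closed_segment a b \<and> (\<exists>t. b - a = of_real t * cis (\<alpha> + \<omega>))}"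

definition sense :: "terrain \<Rightarrow> real \<Rightarrow> complex \<Rightarrow> sensing" where
  "sense T \<omega> v = (if v \<in> frontier (region T) then Boundary (slopes T \<omega> v) else Interior)"

definition learned :: "terrain \<Rightarrow> real \<Rightarrow> real \<Rightarrow> complex list \<Rightarrow> history" where
  "learned T r \<omega> ps =
     map (\<lambda>p. ((p - hd ps) / (of_real r * cis \<omega>), sense T \<omega> p)) ps"

fun run :: "algorithm \<Rightarrow> nat \<Rightarrow> terrain \<Rightarrow> complex \<Rightarrow> real \<Rightarrow> real \<Rightarrow> nat \<Rightarrow> complex list" where
  "run A \<mu> T s r \<omega> 0 = [s]"
| "run A \<mu> T s r \<omega> (Suc n) =
     (let ps = run A \<mu> T s r \<omega> n; a = A \<mu> (learned T r \<omega> ps)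
      in if a = Stop then ps else ps @ [step T r \<omega> (last ps) a])"

text \<open>A route is the list of its vertices \<open>a\<^sub>1, \<dots>, a\<^bsub>k+1\<^esub>\<close>.\<close>

definition is_route ::
  "algorithm \<Rightarrow> nat \<Rightarrow> terrain \<Rightarrow> complex \<Rightarrow> real \<Rightarrow> real \<Rightarrow> complex list \<Rightarrow> bool" where
  "is_route A \<mu> T s r \<omega> ps \<longleftrightarrow>
     (\<exists>n. ps = run A \<mu> T s r \<omega> n \<and> A \<mu> (learned T r \<omega> ps) = Stop)"


section \<open>Walks, rendezvous and cost\<close>

definition is_walk :: "complex list \<Rightarrow> real list \<Rightarrow> (real \<Rightarrow> complex) \<Rightarrow> bool" where
  "is_walk ps ts f \<longleftrightarrow>
     ps \<noteq> [] \<and> length ts = length ps \<and> hd ts = 0 \<and> sorted_wrt (<) ts \<and>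
     (\<forall>i < length ps - 1.
        continuous_on {ts ! i..ts ! Suc i} f \<and>
        f ` {ts ! i..ts ! Suc i} \<subseteq> closed_segment (ps ! i) (ps ! Suc i) \<and>
        f (ts ! i) = ps ! i \<and> f (ts ! Suc i) = ps ! Suc i) \<and>
     (\<forall>t \<ge> last ts. f t = last ps)"

definition rendezvous_algorithm :: "algorithm \<Rightarrow> bool" where
  "rendezvous_algorithm A \<longleftrightarrow>
     (\<forall>T \<mu> s r \<omega>. terrain T \<and> 0 < \<mu> \<and> s \<in> region T \<and> 0 < r \<longrightarrow>
        (\<exists>ps. is_route A \<mu> T s r \<omega> ps)) \<and>
     (\<forall>T \<mu>\<^sub>1 \<mu>\<^sub>2 s\<^sub>1 s\<^sub>2 r\<^sub>1 r\<^sub>2 \<omega>\<^sub>1 \<omega>\<^sub>2 ps\<^sub>1 ps\<^sub>2 ts\<^sub>1 ts\<^sub>2 f\<^sub>1 f\<^sub>2.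
        terrain T \<and> 0 < \<mu>\<^sub>1 \<and> 0 < \<mu>\<^sub>2 \<and> \<mu>\<^sub>1 \<noteq> \<mu>\<^sub>2 \<and>
        s\<^sub>1 \<in> region T \<and> s\<^sub>2 \<in> region T \<and> s\<^sub>1 \<noteq> s\<^sub>2 \<and> 0 < r\<^sub>1 \<and> 0 < r\<^sub>2 \<and>
        is_route A \<mu>\<^sub>1 T s\<^sub>1 r\<^sub>1 \<omega>\<^sub>1 ps\<^sub>1 \<and> is_walk ps\<^sub>1 ts\<^sub>1 f\<^sub>1 \<and>
        is_route A \<mu>\<^sub>2 T s\<^sub>2 r\<^sub>2 \<omega>\<^sub>2 ps\<^sub>2 \<and> is_walk ps\<^sub>2 ts\<^sub>2 f\<^sub>2 \<longrightarrow>
        (\<exists>t\<ge>0. f\<^sub>1 t = f\<^sub>2 t))"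

definition first_meeting :: "(real \<Rightarrow> complex) \<Rightarrow> (real \<Rightarrow> complex) \<Rightarrow> real \<Rightarrow> bool" where
  "first_meeting f\<^sub>1 f\<^sub>2 t \<longleftrightarrow> 0 \<le> t \<and> f\<^sub>1 t = f\<^sub>2 t \<and> (\<forall>t' \<in> {0..<t}. f\<^sub>1 t' \<noteq> f\<^sub>2 t')"

text \<open>The trajectory up to time \<open>t\<close> consists of the completed segments of the route and of the
  portion \<open>[a\<^sub>i, f t]\<close> of the current one. A walk may go back and forth in a segment; this does not
  add to the length.\<close>

definition trajectory_length ::
  "complex list \<Rightarrow> real list \<Rightarrow> (real \<Rightarrow> complex) \<Rightarrow> real \<Rightarrow> real" where
  "trajectory_length ps ts f t =
     (\<Sum>i<length ps - 1.
        if ts ! Suc i \<le> t then dist (ps ! i) (ps ! Suc i)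
        else if ts ! i \<le> t then dist (ps ! i) (f t)
        else 0)"

definition label_length :: "nat \<Rightarrow> nat" where
  "label_length \<mu> = nat \<lfloor>log 2 (real \<mu>)\<rfloor> + 1"

text \<open>The adversary chooses the units of length \<open>r\<^sub>1\<close>, \<open>r\<^sub>2\<close>, the compasses \<open>\<omega>\<^sub>1\<close>, \<open>\<omega>\<^sub>2\<close> and the
  walks. The possible costs of an execution are the values of the total length of the two
  trajectories at the rendezvous.\<close>

definition possible_costs ::
  "algorithm \<Rightarrow> terrain \<Rightarrow> nat \<Rightarrow> nat \<Rightarrow> complex \<Rightarrow> complex \<Rightarrow> real set" where
  "possible_costs A T \<mu>\<^sub>1 \<mu>\<^sub>2 s\<^sub>1 s\<^sub>2 =
     {trajectory_length ps\<^sub>1 ts\<^sub>1 f\<^sub>1 t + trajectory_length ps\<^sub>2 ts\<^sub>2 f\<^sub>2 t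
      | r\<^sub>1 r\<^sub>2 \<omega>\<^sub>1 \<omega>\<^sub>2 ps\<^sub>1 ps\<^sub>2 ts\<^sub>1 ts\<^sub>2 f\<^sub>1 f\<^sub>2 t.
        0 < r\<^sub>1 \<and> 0 < r\<^sub>2 \<and>
        is_route A \<mu>\<^sub>1 T s\<^sub>1 r\<^sub>1 \<omega>\<^sub>1 ps\<^sub>1 \<and> is_walk ps\<^sub>1 ts\<^sub>1 f\<^sub>1 \<and>
        is_route A \<mu>\<^sub>2 T s\<^sub>2 r\<^sub>2 \<omega>\<^sub>2 ps\<^sub>2 \<and> is_walk ps\<^sub>2 ts\<^sub>2 f\<^sub>2 \<and>
        first_meeting f\<^sub>1 f\<^sub>2 t}"

end

theory Submission
  imports Defs
begin

text \<open>The terrain is the region between two concentric squares with axis-parallel sides; the inner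
  one is \<open>[-1, 1] \<times> [-1, 1]\<close> and the outer one is large.

  First, some label of length \<open>k\<close> has a route of length at least \<open>k / 8\<close>. Let the agents walk at speed
  at most \<open>1\<close> and record every half unit of time in which of the four axis directions an agent is
  farthest from the centre. Until the next record it stays in the open half-plane of that
  direction. There are fewer possible records of short routes than labels, so two labels have the same
  one. Started at antipodal points with opposite compasses, the second agent follows the reflected
  route, so at every time the position of the first and the reflected position of the second lie in
  a common open half-plane, and the agents never meet.

  Secondly, an agent can be made to traverse its whole route: the other one starts arbitrarily
  close, but off this route, which has measure zero, and hardly moves. For \<open>k\<close> large compared with
  the perimeter, the length \<open>k / 8\<close> of the route dominates the whole bound.\<close>

subsection \<open>Chains and walks\<close>

text \<open>The term \<open>set ps\<close> covers a route with a single vertex, which has no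
  segments but still occupies a point.\<close>

definition trace :: "complex list \<Rightarrow> complex set" where
  "trace ps = set ps \<union> (\<Union>i<length ps - 1. closed_segment (ps ! i) (ps ! Suc i))"

lemma trace_single: "trace [a] = {a}"
  by (simp add: trace_def)

lemma trace_snoc:
  assumes "ps \<noteq> []"
  shows "trace (ps @ [q]) = trace ps \<union> closed_segment (last ps) q"
proof -
  obtain n where n: "length ps = Suc n"
    using assms by (cases "length ps") auto
  have "(\<Union>i<Suc n. closed_segment ((ps @ [q]) ! i) ((ps @ [q]) ! Suc i))
      = (\<Union>i<n. closed_segment (ps ! i) (ps ! Suc i)) \<union> closed_segment (last ps) q"
    using n assms by (auto simp: lessThan_Suc nth_append last_conv_nth)
  then show ?thesis
    using n assms by (auto simp: trace_def)
qed

lemma chain_length_single: "chain_length [a] = 0"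
  by (simp add: chain_length_def)

lemma chain_length_snoc:
  assumes "ps \<noteq> []"
  shows "chain_length (ps @ [q]) = chain_length ps + dist (last ps) q"
proof -
  obtain n where n: "length ps = Suc n"
    using assms by (cases "length ps") auto
  then show ?thesis
    using assms by (simp add: chain_length_def nth_append last_conv_nth)
qed

lemma trajectory_length_nonneg: "0 \<le> trajectory_length ps ts f t"
  unfolding trajectory_length_def by (intro sum_nonneg) auto

lemma is_walk_start:
  assumes "is_walk ps ts f"
  shows "f 0 = hd ps"
proof (cases "length ps = 1")
  case True
  then obtain p s where "ps = [p]" "ts = [s]"
    using assms by (metis One_nat_def Suc_length_conv is_walk_def length_0_conv)
  then show ?thesis
    using assms by (auto simp: is_walk_def)
next
  case False
  then have "0 < length ps - 1"
    using assms by (cases ps) (auto simp: is_walk_def)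
  then have "f (ts ! 0) = ps ! 0"
    using assms by (auto simp: is_walk_def)
  moreover have "ps \<noteq> []" "ts \<noteq> []" "hd ts = 0"
    using assms by (auto simp: is_walk_def)
  then have "ts ! 0 = 0" "ps ! 0 = hd ps"
    by (auto simp: hd_conv_nth)
  ultimately show ?thesis by simp
qed

lemma is_walk_times_le_last:
  assumes "is_walk ps ts f" "i < length ts"
  shows "ts ! i \<le> last ts"
proof -
  have "ts \<noteq> []" and s: "sorted_wrt (<) ts"
    using assms by (auto simp: is_walk_def)
  then have "last ts = ts ! (length ts - 1)"
    by (simp add: last_conv_nth)
  moreover have "i = length ts - 1 \<or> ts ! i < ts ! (length ts - 1)"
    using sorted_wrt_nth_less[OF s, of i "length ts - 1"] assms(2) by linarith
  ultimately show ?thesis by force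
qed

lemma trajectory_length_complete:
  assumes "is_walk ps ts f" "last ts \<le> t"
  shows "trajectory_length ps ts f t = chain_length ps"
proof -
  have "ts ! Suc i \<le> t" if "i < length ps - 1" for i
  proof -
    have "Suc i < length ts"
      using that assms(1) by (auto simp: is_walk_def)
    then show ?thesis
      using is_walk_times_le_last[OF assms(1)] assms(2) by fastforce
  qed
  then show ?thesis
    unfolding trajectory_length_def chain_length_def by (intro sum.cong) auto
qed

section \<open>Reflected and slowed-down walks\<close>

lemma uminus_in_closed_segment:
  "- v \<in> closed_segment (- a) (- b) \<longleftrightarrow> v \<in> closed_segment a (b :: complex)"
proof -
  have "- v = (1 - u) *\<^sub>R (- a) + u *\<^sub>R (- b) \<longleftrightarrow> v = (1 - u) *\<^sub>R a + u *\<^sub>R b" for u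
    by (metis add.inverse_inverse minus_add_distrib scaleR_minus_right)
  then show ?thesis
    by (simp only: in_segment)
qed

lemma is_walk_uminus:
  assumes "is_walk ps ts f"
  shows "is_walk (map uminus ps) ts (\<lambda>t. - f t)"
  using assms unfolding is_walk_def
  by (auto simp: last_map
      intro!: continuous_intros uminus_in_closed_segment[THEN iffD2])

text \<open>A small \<open>k\<close> makes the agent hardly move during any prescribed bounded time;
  this is how the adversary holds one agent back while the other completes its route.\<close>

lemma is_walk_slowdown:
  assumes "is_walk ps ts f" "0 < k"
  shows "is_walk ps (map (\<lambda>t. t / k) ts) (\<lambda>t. f (k * t))"
proof -
  have "ts \<noteq> []" and len: "length ts = length ps"
    using assms by (auto simp: is_walk_def)
  have piece: "continuous_on {ts ! i / k..ts ! Suc i / k} (\<lambda>t. f (k * t))"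
    "(\<lambda>t. f (k * t)) ` {ts ! i / k..ts ! Suc i / k} \<subseteq> closed_segment (ps ! i) (ps ! Suc i)"
    if "i < length ps - 1" for i
  proof -
    have im: "(*) k ` {ts ! i / k..ts ! Suc i / k} \<subseteq> {ts ! i..ts ! Suc i}"
      using assms(2) by (auto simp: field_simps)
    have c: "continuous_on {ts ! i..ts ! Suc i} f"
      and s: "f ` {ts ! i..ts ! Suc i} \<subseteq> closed_segment (ps ! i) (ps ! Suc i)"
      using assms(1) that by (auto simp: is_walk_def)
    show "continuous_on {ts ! i / k..ts ! Suc i / k} (\<lambda>t. f (k * t))"
      by (rule continuous_on_compose2[OF c _ im]) (intro continuous_intros)
    show "(\<lambda>t. f (k * t)) ` {ts ! i / k..ts ! Suc i / k} \<subseteq> closed_segment (ps ! i) (ps ! Suc i)"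
      using im s by blast
  qed
  have "sorted_wrt (<) (map (\<lambda>t. t / k) ts)"
    using assms by (auto simp: is_walk_def sorted_wrt_map divide_strict_right_mono
      intro: sorted_wrt_mono_rel[of ts "(<)"])
  then show ?thesis
    using assms \<open>ts \<noteq> []\<close> len piece unfolding is_walk_def
    by (auto simp: hd_map last_map pos_divide_le_eq mult.commute)
qed

section \<open>Walks of speed at most 1\<close>

lemma lipschitz_on_atLeast_concat:
  fixes f g :: "real \<Rightarrow> 'a::metric_space"
  assumes "L-lipschitz_on {a..b} f" "L-lipschitz_on {b..} g" "f b = g b"
  shows "L-lipschitz_on {a..} (\<lambda>t. if t \<le> b then f t else g t)"
proof (rule lipschitz_onI)
  show "0 \<le> L"
    using assms(2) by (rule lipschitz_on_nonneg)
  fix x y assume "x \<in> {a..}" "y \<in> {a..}"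
  \<comment> \<open>Any two points lie in a bounded interval ending at the larger one, so
    concatenation on bounded intervals suffices.\<close>
  moreover have "L-lipschitz_on {a..max x y} (\<lambda>t. if t \<le> b then f t else g t)"
    using assms by (intro lipschitz_on_concat) (auto intro: lipschitz_on_subset)
  ultimately show "dist (if x \<le> b then f x else g x) (if y \<le> b then f y else g y) \<le> L * dist x y"
    by (intro lipschitz_onD[where f = "\<lambda>t. if t \<le> b then f t else g t"]) auto
qed

text \<open>The extra time \<open>e\<close> is needed because a walk has to spend a positive time on each segment of
  length \<open>0\<close>.\<close>

lemma lipschitz_walk_exists:
  assumes "ps \<noteq> []" "0 < e"
  shows "\<exists>ts f. is_walk ps ts f \<and> 1-lipschitz_on {0..} f \<and> f ` {0..} \<subseteq> trace ps \<and>
    0 \<le> last ts \<and> last ts \<le> chain_length ps + e"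
  using assms
proof (induction ps arbitrary: e rule: rev_nonempty_induct)
  case (single a)
  have "is_walk [a] [0] (\<lambda>_. a)"
    by (simp add: is_walk_def)
  moreover have "1-lipschitz_on {0..} (\<lambda>_::real. a)"
    by (rule lipschitz_onI) auto
  ultimately show ?case
    using single by (intro exI[of _ "[0]"] exI[of _ "\<lambda>_. a"])
      (auto simp: trace_single chain_length_single)
next
  case (snoc q ps)
  obtain ts f where w: "is_walk ps ts f" and lip: "1-lipschitz_on {0..} f"
    and tr: "f ` {0..} \<subseteq> trace ps" and T: "0 \<le> last ts" "last ts \<le> chain_length ps + e / 2"
    using snoc.IH[of "e / 2"] snoc.prems by auto
  define T where "T = last ts"
  define p where "p = last ps"
  \<comment> \<open>The last segment is walked at constant speed in time \<open>d\<close>. As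
    \<open>d\<close> is at least \<open>dist p q\<close>, the speed is at most 1; the other half of
    \<open>e\<close> was spent on the earlier segments.\<close>
  define d where "d = dist p q + e / 2"
  \<comment> \<open>Cutting the time off at \<open>T + d\<close> makes the agent inert at
    \<open>q\<close> from then on.\<close>
  define g where "g t = p + ((min t (T + d) - T) / d) *\<^sub>R (q - p)" for t
  define h where "h t = (if t \<le> T then f t else g t)" for t
  have d: "0 < d" "dist p q \<le> d"
    using snoc.prems by (auto simp: d_def add_nonneg_pos)
  have "ts \<noteq> []" "length ts = length ps"
    using w by (auto simp: is_walk_def)
  have fT: "f T = p" "g T = p" "g (T + d) = q"
    using w d by (auto simp: is_walk_def T_def g_def p_def)
  have g_end: "g t = q" if "T + d \<le> t" for t
    using that d by (simp add: g_def)
  have g_seg: "g t \<in> closed_segment p q" if "T \<le> t" for t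
  proof -
    have "0 \<le> (min t (T + d) - T) / d" "(min t (T + d) - T) / d \<le> 1"
      using d that by (auto simp: field_simps)
    then show ?thesis
      unfolding g_def in_segment
      by (intro exI[of _ "(min t (T + d) - T) / d"]) (auto simp: algebra_simps)
  qed
  have g_lip: "1-lipschitz_on {T..} g"
  proof (rule lipschitz_onI)
    fix x y
    have "dist (g x) (g y) = \<bar>min x (T + d) - min y (T + d)\<bar> / d * dist p q"
      using d by (simp add: g_def dist_norm norm_minus_commute[of p q] flip: scaleR_diff_left
        diff_divide_distrib)
    also have "\<dots> \<le> \<bar>min x (T + d) - min y (T + d)\<bar> / d * d"
      using d by (intro mult_left_mono) auto
    also have "\<dots> \<le> 1 * dist x y"
      using d by (auto simp: dist_real_def)
    finally show "dist (g x) (g y) \<le> 1 * dist x y" .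
  qed simp
  have h_lip: "1-lipschitz_on {0..} h"
    unfolding h_def using lip g_lip fT
    by (intro lipschitz_on_atLeast_concat) (auto intro: lipschitz_on_subset)
  have h_f: "h t = f t" if "t \<le> T" for t
    using that by (simp add: h_def)
  have h_g: "h t = g t" if "T \<le> t" for t
    using that fT by (auto simp: h_def)
  have nth_le: "ts ! i \<le> T" if "i < length ts" for i
    using is_walk_times_le_last[OF w that] by (simp add: T_def)
  have "0 \<le> ts ! i" if "i < length ts" for i
  proof -
    have "ts ! 0 = 0" "sorted_wrt (<) ts"
      using w \<open>ts \<noteq> []\<close> by (auto simp: is_walk_def hd_conv_nth)
    then show ?thesis
      using sorted_wrt_nth_less[of "(<)" ts 0 i] that by (cases "i = 0") force+
  qed
  then have "{(ts @ [T + d]) ! i..(ts @ [T + d]) ! Suc i} \<subseteq> {0..}" if "i < length ps" for i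
    using that \<open>length ts = length ps\<close> by (force simp: nth_append)
  then have h_cont: "continuous_on {(ts @ [T + d]) ! i..(ts @ [T + d]) ! Suc i} h"
    if "i < length ps" for i
    using lipschitz_on_continuous_on[OF h_lip] continuous_on_subset that by blast
  have "sorted_wrt (<) (ts @ [T + d])"
  proof -
    have "t < T + d" if "t \<in> set ts" for t
      using that nth_le d by (force simp: in_set_conv_nth)
    then show ?thesis
      using w by (auto simp: is_walk_def sorted_wrt_append)
  qed
  moreover have "h ` {(ts @ [T + d]) ! i..(ts @ [T + d]) ! Suc i}
        \<subseteq> closed_segment ((ps @ [q]) ! i) ((ps @ [q]) ! Suc i) \<and>
      h ((ts @ [T + d]) ! i) = (ps @ [q]) ! i \<and> h ((ts @ [T + d]) ! Suc i) = (ps @ [q]) ! Suc i"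
    if "i < length ps" for i
  proof (cases "Suc i = length ps")
    case True
    then have "ts ! i = T" "ps ! i = p"
      using \<open>length ts = length ps\<close> \<open>ts \<noteq> []\<close> snoc.hyps
      by (auto simp: T_def p_def last_conv_nth simp flip: True)
    then show ?thesis
      using True \<open>length ts = length ps\<close> fT d g_seg
      by (auto simp: nth_append h_g)
  next
    case False
    then have i: "i < length ps - 1" "Suc i < length ps"
      using that by auto
    then have "f ` {ts ! i..ts ! Suc i} \<subseteq> closed_segment (ps ! i) (ps ! Suc i)"
      "f (ts ! i) = ps ! i" "f (ts ! Suc i) = ps ! Suc i"
      using w by (auto simp: is_walk_def)
    moreover have "h t = f t" if "t \<le> ts ! Suc i" for t
      using that nth_le[of "Suc i"] i \<open>length ts = length ps\<close> by (intro h_f) auto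
    ultimately show ?thesis
      using i \<open>length ts = length ps\<close> nth_le[of i] by (auto simp: nth_append h_f)
  qed
  moreover have "h t = q" if "T + d \<le> t" for t
    using that d g_end h_g by auto
  ultimately have "is_walk (ps @ [q]) (ts @ [T + d]) h"
    using w h_cont \<open>length ts = length ps\<close> \<open>ts \<noteq> []\<close> unfolding is_walk_def by auto
  moreover have "h ` {0..} \<subseteq> trace (ps @ [q])"
    using tr g_seg snoc.hyps by (auto simp: h_def trace_snoc p_def)
  moreover have "last (ts @ [T + d]) \<le> chain_length (ps @ [q]) + e"
    using T snoc.hyps by (simp add: chain_length_snoc T_def d_def p_def)
  moreover have "0 \<le> last (ts @ [T + d])"
    using T d by (simp add: T_def)
  ultimately show ?case
    using h_lip by blast
qed


subsection \<open>Routes stay in the terrain\<close>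

lemma finite_boundary_segments: "finite (boundary_segments T)"
proof -
  have "polygon_sides vs = (\<lambda>i. (vs ! i, vs ! (Suc i mod length vs))) ` {..<length vs}" for vs
    by (auto simp: polygon_sides_def)
  then have "finite (polygon_sides vs)" for vs
    by simp
  then show ?thesis
    by (auto simp: boundary_segments_def Let_def)
qed

text \<open>Each distance is \<open>norm (b - v)\<close> for an end \<open>b\<close> of one of the
  finitely many segments. Finiteness ensures that the \<open>Min\<close> in \<open>follow\<close>
  and \<open>follow_to_end\<close> is attained.\<close>

lemma finite_end_distances: "finite (end_distances T v \<alpha>)"
proof (rule finite_subset)
  show "end_distances T v \<alpha> \<subseteq> (\<lambda>(a, b). norm (b - v)) ` boundary_segments T"
    by (force simp: end_distances_def norm_mult)
  show "finite ((\<lambda>(a, b). norm (b - v)) ` boundary_segments T)"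
    by (intro finite_imageI finite_boundary_segments)
qed

lemma closed_segment_scaled:
  assumes "0 \<le> d" "d \<le> t"
  shows "v + of_real d * w \<in> closed_segment v (v + of_real t * (w :: complex))"
proof (cases "t = 0")
  case False
  then show ?thesis
    using assms unfolding in_segment
    by (intro exI[of _ "d / t"]) (auto simp: algebra_simps scaleR_conv_of_real)
qed (use assms in auto)

text \<open>All points strictly between \<open>v\<close> and the end of the move are interior to the
  region, by the choice of the supremum. The end itself may be a boundary point; it is a limit of
  such points, so closedness of the region supplies it.\<close>

lemma go_segment:
  assumes "closed (region T)" "v \<in> region T"
  shows "closed_segment v (go T v \<alpha> d) \<subseteq> region T"
proof -
  define A where "A = {t. 0 \<le> t \<and> t \<le> max 0 d \<and>
    (\<forall>s \<in> {0<..<t}. v + of_real s * cis \<alpha> \<in> interior (region T))}"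
  have "0 \<in> A" "bdd_above A"
    by (auto simp: A_def intro!: bdd_aboveI[of _ "max 0 d"])
  then have "0 \<le> Sup A"
    by (rule cSup_upper)
  have inside: "v + of_real s * cis \<alpha> \<in> region T" if s: "0 < s" "s < Sup A" for s
  proof -
    obtain t where "t \<in> A" "s < t"
      using less_cSupD[of A s] s \<open>0 \<in> A\<close> by auto
    then have "v + of_real s * cis \<alpha> \<in> interior (region T)"
      using s by (simp add: A_def)
    then show ?thesis
      using interior_subset by blast
  qed
  have "closed_segment v (v + of_real (Sup A) * cis \<alpha>) \<subseteq> region T"
  proof (cases "Sup A = 0")
    case False
    define z where "z = v + of_real (Sup A) * cis \<alpha>"
    have "open_segment v z \<subseteq> region T"
    proof
      fix x assume "x \<in> open_segment v z"
      then obtain u where u: "0 < u" "u < 1" "x = (1 - u) *\<^sub>R v + u *\<^sub>R z"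
        by (auto simp: in_segment)
      have "x = v + of_real (u * Sup A) * cis \<alpha>"
        by (simp add: u z_def algebra_simps scaleR_conv_of_real)
      then show "x \<in> region T"
        using inside[of "u * Sup A"] u False \<open>0 \<le> Sup A\<close> by auto
    qed
    then have "closure (open_segment v z) \<subseteq> region T"
      using assms(1) by (rule closure_minimal)
    moreover have "v \<noteq> z"
      using False by (simp add: z_def)
    ultimately show ?thesis
      by (simp add: closure_open_segment z_def)
  qed (use assms in auto)
  then show ?thesis
    by (simp add: go_def A_def)
qed

lemma follow_segment:
  assumes "\<And>a b. (a, b) \<in> boundary_segments T \<Longrightarrow> closed_segment a b \<subseteq> region T" "v \<in> region T"
  shows "closed_segment v (follow T v \<alpha> d) \<subseteq> region T"
proof (cases "end_distances T v \<alpha> = {}")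
  case False
  define t where "t = Min (end_distances T v \<alpha>)"
  have "t \<in> end_distances T v \<alpha>"
    unfolding t_def using False finite_end_distances by (rule Min_in[rotated])
  then obtain a b where ab: "0 < t" "(a, b) \<in> boundary_segments T" "v \<in> closed_segment a b"
    "b = v + of_real t * cis \<alpha>"
    by (auto simp: end_distances_def)
  have "v + of_real (min (max 0 d) t) * cis \<alpha> \<in> closed_segment v b"
    unfolding ab(4) using ab(1) by (intro closed_segment_scaled) auto
  also have "\<dots> \<subseteq> closed_segment a b"
    using ab(3) by (simp add: subset_closed_segment)
  finally show ?thesis
    using ab(3) assms(1)[OF ab(2)] False subset_closed_segment
    by (fastforce simp: follow_def t_def)
qed (use assms in \<open>auto simp: follow_def\<close>)

text \<open>Reduces the last kind of action to \<open>follow\<close>, so that containment and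
  symmetry have to be proved only for \<open>go\<close> and \<open>follow\<close>.\<close>

lemma follow_to_end_eq_follow: "follow_to_end T v \<alpha> = follow T v \<alpha> (Min (end_distances T v \<alpha>))"
proof (cases "end_distances T v \<alpha> = {}")
  case False
  then have "Min (end_distances T v \<alpha>) \<in> end_distances T v \<alpha>"
    using finite_end_distances by (rule Min_in[rotated])
  then have "0 < Min (end_distances T v \<alpha>)"
    by (auto simp: end_distances_def)
  then show ?thesis
    by (simp add: follow_def follow_to_end_def)
qed (simp add: follow_def follow_to_end_def)

lemma step_segment:
  assumes "closed (region T)"
    and "\<And>a b. (a, b) \<in> boundary_segments T \<Longrightarrow> closed_segment a b \<subseteq> region T"
    and "v \<in> region T"
  shows "closed_segment v (step T r \<omega> v a) \<subseteq> region T"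
  using assms go_segment follow_segment by (cases a) (simp_all add: follow_to_end_eq_follow)

lemma run_nonempty: "run A \<mu> T s r \<omega> n \<noteq> []"
  by (induction n) (auto simp: Let_def)

lemma hd_run: "hd (run A \<mu> T s r \<omega> n) = s"
  using run_nonempty[of A \<mu> T s r \<omega>] by (induction n) (auto simp: Let_def)

lemma last_in_trace: "ps \<noteq> [] \<Longrightarrow> last ps \<in> trace ps"
  by (simp add: trace_def)

lemma trace_run:
  assumes "closed (region T)"
    and "\<And>a b. (a, b) \<in> boundary_segments T \<Longrightarrow> closed_segment a b \<subseteq> region T"
    and "s \<in> region T"
  shows "trace (run A \<mu> T s r \<omega> n) \<subseteq> region T"
proof (induction n)
  case 0
  then show ?case
    using assms by (simp add: trace_single)
next
  case (Suc n)
  then have "last (run A \<mu> T s r \<omega> n) \<in> region T"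
    using last_in_trace[OF run_nonempty] by blast
  then show ?case
    using Suc step_segment[OF assms(1,2)] by (simp add: Let_def trace_snoc run_nonempty)
qed


subsection \<open>Central symmetry\<close>

text \<open>The two conditions cover all that an execution depends on: \<open>go\<close> and the
  distinction between interior and boundary use the region, while \<open>follow\<close> and
  \<open>slopes\<close> use the boundary segments.\<close>

definition centrally_symmetric :: "terrain \<Rightarrow> bool" where
  "centrally_symmetric T \<longleftrightarrow>
     uminus ` region T = region T \<and>
     (\<forall>a b. (a, b) \<in> boundary_segments T \<longrightarrow> (- a, - b) \<in> boundary_segments T)"

lemma cis_add_pi: "cis (\<alpha> + pi) = - cis \<alpha>"
  by (simp flip: cis_mult)

context
  fixes T
  assumes sym: "centrally_symmetric T"
begin

lemma sym_segments: "(- a, - b) \<in> boundary_segments T \<longleftrightarrow> (a, b) \<in> boundary_segments T"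
  using sym by (metis add.inverse_inverse centrally_symmetric_def)

lemma ex_segment_uminus:
  "(\<exists>(a, b) \<in> boundary_segments T. P a b) \<longleftrightarrow> (\<exists>(a, b) \<in> boundary_segments T. P (- a) (- b))"
proof -
  have "(\<exists>a b. Q a b) \<longleftrightarrow> (\<exists>a b. Q (- a) (- b))" for Q :: "complex \<Rightarrow> complex \<Rightarrow> bool"
    by (metis add.inverse_inverse)
  from this[of "\<lambda>a b. (a, b) \<in> boundary_segments T \<and> P a b"] show ?thesis
    by (auto simp: sym_segments split_beta' Bex_def)
qed

lemma sym_interior: "- z \<in> interior (region T) \<longleftrightarrow> z \<in> interior (region T)"
proof -
  have "uminus ` interior (region T) = interior (region T)"
    using sym interior_negations[of "region T"] by (simp add: centrally_symmetric_def)
  then show ?thesis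
    by (metis add.inverse_inverse imageI)
qed

lemma sym_frontier: "- z \<in> frontier (region T) \<longleftrightarrow> z \<in> frontier (region T)"
proof -
  have "uminus ` closure (region T) = closure (region T)"
    using sym closure_scaleR[of "- 1" "region T"] by (simp add: centrally_symmetric_def)
  then have "- z \<in> closure (region T) \<longleftrightarrow> z \<in> closure (region T)"
    by (metis add.inverse_inverse imageI)
  then show ?thesis
    by (simp add: frontier_def sym_interior)
qed

lemma go_uminus: "go T (- v) (\<alpha> + pi) d = - go T v \<alpha> d"
proof -
  have "- v + of_real s * cis (\<alpha> + pi) \<in> interior (region T) \<longleftrightarrow>
      v + of_real s * cis \<alpha> \<in> interior (region T)" for s
    using sym_interior[of "v + of_real s * cis \<alpha>"] by (simp add: cis_add_pi)
  then show ?thesis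
    by (simp add: go_def cis_add_pi)
qed

lemma end_distances_uminus: "end_distances T (- v) (\<alpha> + pi) = end_distances T v \<alpha>"
proof -
  have "- b = - v + of_real t * cis (\<alpha> + pi) \<longleftrightarrow> b = v + of_real t * cis \<alpha>" for b t
    by (metis (no_types, lifting) add.inverse_inverse cis_add_pi minus_add_distrib mult_minus_right)
  then show ?thesis
    unfolding end_distances_def
    by (subst ex_segment_uminus) (simp add: uminus_in_closed_segment)
qed

lemma follow_uminus: "follow T (- v) (\<alpha> + pi) d = - follow T v \<alpha> d"
  by (simp add: follow_def end_distances_uminus cis_add_pi)

lemma step_uminus: "step T r (\<omega> + pi) (- v) a = - step T r \<omega> v a"
  by (cases a) (simp_all add: follow_to_end_eq_follow go_uminus follow_uminus end_distances_uminus
      flip: add.assoc)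

text \<open>Reflection reverses the segments and turning the compass by \<open>pi\<close> reverses
  the reference direction, so every slope keeps its private angle.\<close>

lemma sense_uminus: "sense T (\<omega> + pi) (- v) = sense T \<omega> v"
proof -
  have "(\<exists>t. - b - - a = of_real t * cis (\<alpha> + (\<omega> + pi))) \<longleftrightarrow>
      (\<exists>t. b - a = of_real t * cis (\<alpha> + \<omega>))" for a b \<alpha>
  proof -
    have "- b - - a = of_real t * cis (\<alpha> + (\<omega> + pi)) \<longleftrightarrow> b - a = of_real t * cis (\<alpha> + \<omega>)" for t
      using cis_add_pi[of "\<alpha> + \<omega>"] by (simp add: add.assoc) (metis minus_diff_eq minus_minus)
    then show ?thesis
      by simp
  qed
  then have "slopes T (\<omega> + pi) (- v) = slopes T \<omega> v"
    unfolding slopes_def by (subst ex_segment_uminus) (simp add: uminus_in_closed_segment)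
  then show ?thesis
    by (simp add: sense_def sym_frontier)
qed

text \<open>Both the displacements and the unit vector of North change sign, so the private
  displacements agree: the reflected agent learns exactly the same.\<close>

lemma learned_uminus:
  assumes "ps \<noteq> []"
  shows "learned T r (\<omega> + pi) (map uminus ps) = learned T r \<omega> ps"
proof -
  have "(- p - - q) / (of_real r * cis (\<omega> + pi)) = (p - q) / (of_real r * cis \<omega>)" for p q
  proof -
    have "- p - - q = - (p - q)" "of_real r * cis (\<omega> + pi) = - (of_real r * cis \<omega>)"
      by (simp_all add: cis_add_pi)
    then show ?thesis
      by (metis minus_divide_divide)
  qed
  then show ?thesis
    using assms by (simp add: learned_def hd_map sense_uminus)
qed

text \<open>By induction: equal histories yield equal actions, and with the compass turned by
  \<open>pi\<close> an equal action leads from the reflected point to the reflected end.\<close>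

lemma run_uminus: "run A \<mu> T (- s) r (\<omega> + pi) n = map uminus (run A \<mu> T s r \<omega> n)"
  by (induction n) (simp_all add: Let_def learned_uminus run_nonempty last_map step_uminus)

lemma is_route_uminus:
  assumes "is_route A \<mu> T s r \<omega> ps"
  shows "is_route A \<mu> T (- s) r (\<omega> + pi) (map uminus ps)"
  using assms by (auto simp: is_route_def run_uminus learned_uminus run_nonempty)

end


subsection \<open>The square annulus\<close>

text \<open>The corners are in the order of \<open>rectpath\<close>, to which the closed polygonal
  path through them unfolds.\<close>

definition square :: "real \<Rightarrow> complex list" where
  "square a = [Complex (- a) (- a), Complex a (- a), Complex a a, Complex (- a) a]"

definition annulus :: "real \<Rightarrow> terrain" where
  "annulus R = \<lparr>outer = square R, obstacles = [square 1]\<rparr>"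

lemma polygon_curve_square:
  assumes "0 < a"
  shows "polygon_curve (square a) =
    cbox (Complex (- a) (- a)) (Complex a a) - box (Complex (- a) (- a)) (Complex a a)"
  using assms path_image_rectpath_cbox_minus_box[of "Complex (- a) (- a)" "Complex a a"]
  by (simp add: polygon_curve_def square_def rectpath_def Let_def)

lemma box_square: "box (Complex (- a) (- a)) (Complex a a) = {z. \<bar>Re z\<bar> < a \<and> \<bar>Im z\<bar> < a}"
  by (auto simp: in_box_complex_iff)

lemma cbox_square: "cbox (Complex (- a) (- a)) (Complex a a) = {z. \<bar>Re z\<bar> \<le> a \<and> \<bar>Im z\<bar> \<le> a}"
  by (auto simp: in_cbox_complex_iff)

text \<open>The curve is the frontier of a box, and the inside of the frontier of a bounded convex
  set is the interior of the set.\<close>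

lemma open_polygon_square:
  assumes "0 < a"
  shows "open_polygon (square a) = {z. \<bar>Re z\<bar> < a \<and> \<bar>Im z\<bar> < a}"
proof -
  have "box (Complex (- a) (- a)) (Complex a a) \<noteq> {}"
    using assms by (auto simp: box_square intro!: exI[of _ 0])
  then have "frontier (cbox (Complex (- a) (- a)) (Complex a a)) = polygon_curve (square a)"
    by (simp add: polygon_curve_square[OF assms] frontier_cbox)
  then show ?thesis
    unfolding open_polygon_def box_square[symmetric]
    by (metis bounded_cbox convex_box(1) inside_frontier_eq_interior interior_cbox)
qed

lemma closed_polygon_square:
  assumes "0 < a"
  shows "closed_polygon (square a) = {z. \<bar>Re z\<bar> \<le> a \<and> \<bar>Im z\<bar> \<le> a}"
  using open_polygon_square[OF assms]
  by (auto simp: closed_polygon_def open_polygon_def polygon_curve_square[OF assms] cbox_square box_square)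

lemma polygon_square:
  assumes "0 < a"
  shows "polygon (square a)"
proof -
  have "simple_path (polygonal_path (square a @ [hd (square a)]))"
    using assms simple_path_rectpath[of "Complex (- a) (- a)" "Complex a a"]
    by (simp add: square_def rectpath_def Let_def)
  \<comment> \<open>Going around a square, the two coordinates change alternately; the two
    statements are the two kinds of turn.\<close>
  moreover have corner: "\<not> collinear {Complex x y, Complex x' y, Complex x' y'}"
      "\<not> collinear {Complex x y, Complex x y', Complex x' y'}" if "x \<noteq> x'" "y \<noteq> y'" for x y x' y'
    using that by (auto simp: collinear_3 collinear_lemma complex_eq_iff)
  have "\<not> collinear {square a ! i, square a ! (Suc i mod length (square a)),
      square a ! (Suc (Suc i) mod length (square a))}" if "i < length (square a)" for i
  proof -
    have "i \<in> {0, 1, 2, 3}"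
      using that by (auto simp: square_def)
    then show ?thesis
      using assms corner by (auto simp: square_def)
  qed
  ultimately show ?thesis
    by (simp add: polygon_def) (simp add: square_def)
qed

lemma chain_length_Cons: "chain_length (a # b # ps) = dist a b + chain_length (b # ps)"
  by (simp add: chain_length_def sum.lessThan_Suc_shift del: sum.lessThan_Suc)

lemma perimeter_square:
  assumes "0 < a"
  shows "perimeter (square a) = 8 * a"
  using assms by (simp add: perimeter_def square_def chain_length_Cons chain_length_single dist_norm
    cmod_def real_sqrt_mult)

lemma polygon_sides_square:
  "polygon_sides (square c) = {(Complex (- c) (- c), Complex c (- c)), (Complex c (- c), Complex c c),
    (Complex c c, Complex (- c) c), (Complex (- c) c, Complex (- c) (- c))}"
proof -
  have "{i. i < length (square c)} = {0, 1, 2, 3}"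
    by (auto simp: square_def)
  then show ?thesis
    unfolding polygon_sides_def setcompr_eq_image by (simp add: square_def)
qed

lemma polygon_sides_square_curve:
  "(a, b) \<in> polygon_sides (square c) \<Longrightarrow> closed_segment a b \<subseteq> polygon_curve (square c)"
  unfolding polygon_sides_square polygon_curve_def by (auto simp: square_def path_image_join)

text \<open>Negation is a half-turn, so it takes each side to the opposite one with the orientation
  of the cycle preserved.\<close>

lemma polygon_sides_square_uminus:
  assumes "(a, b) \<in> polygon_sides (square c)"
  shows "(- a, - b) \<in> polygon_sides (square c)"
proof -
  have "- Complex x y = Complex (- x) (- y)" for x y
    by (simp add: complex_eq_iff)
  then show ?thesis
    using assms unfolding polygon_sides_square by auto
qed

text \<open>The bound \<open>2\<close> leaves room for a disc of radius 1/2 about the starting point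
  3/2 between the inner and the outer square.\<close>

context
  fixes R :: real
  assumes R: "2 \<le> R"
begin

lemma region_annulus:
  "region (annulus R) = {z. \<bar>Re z\<bar> \<le> R \<and> \<bar>Im z\<bar> \<le> R \<and> (1 \<le> \<bar>Re z\<bar> \<or> 1 \<le> \<bar>Im z\<bar>)}"
  using R by (auto simp: region_def annulus_def closed_polygon_square open_polygon_square)

lemma terrain_annulus: "terrain (annulus R)"
  using R by (auto simp: terrain_def annulus_def polygon_square closed_polygon_square open_polygon_square)

lemma closed_region_annulus: "closed (region (annulus R))"
  unfolding region_annulus
  by (intro closed_Collect_conj closed_Collect_disj closed_Collect_le continuous_intros)

lemma boundary_segments_annulus:
  assumes "(a, b) \<in> boundary_segments (annulus R)"
  shows "closed_segment a b \<subseteq> region (annulus R)"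
proof -
  consider "(a, b) \<in> polygon_sides (square R)" | "(a, b) \<in> polygon_sides (square 1)"
    | "(b, a) \<in> polygon_sides (square R)" | "(b, a) \<in> polygon_sides (square 1)"
    using assms by (auto simp: boundary_segments_def annulus_def Let_def)
  then have "closed_segment a b \<subseteq> polygon_curve (square R) \<or> closed_segment a b \<subseteq> polygon_curve (square 1)"
    by cases (auto dest!: polygon_sides_square_curve simp: closed_segment_commute)
  moreover have "polygon_curve (square R) \<subseteq> region (annulus R)"
    "polygon_curve (square 1) \<subseteq> region (annulus R)"
    using R by (auto simp: polygon_curve_square cbox_square box_square region_annulus)
  ultimately show ?thesis by blast
qed

lemma centrally_symmetric_annulus: "centrally_symmetric (annulus R)"
proof -
  have "z \<in> uminus ` region (annulus R)" if "z \<in> region (annulus R)" for z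
    using that by (intro image_eqI[of _ _ "- z"]) (simp_all add: region_annulus)
  moreover have "- z \<in> region (annulus R)" if "z \<in> region (annulus R)" for z
    using that by (simp add: region_annulus)
  ultimately have "uminus ` region (annulus R) = region (annulus R)"
    by blast
  then show ?thesis
    unfolding centrally_symmetric_def
    by (auto simp: boundary_segments_def annulus_def Let_def intro: polygon_sides_square_uminus)
qed

lemma total_perimeter_annulus: "total_perimeter (annulus R) = 8 * R + 8"
  using R by (simp add: total_perimeter_def annulus_def perimeter_square)

lemma largest_obstacle_perimeter_annulus: "largest_obstacle_perimeter (annulus R) = 8"
  by (simp add: largest_obstacle_perimeter_def annulus_def perimeter_square)

end


subsection \<open>Distances\<close>

text \<open>Distances between increasing parameters on a segment telescope.\<close>

lemma chain_length_linepath: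
  assumes "sorted ts"
  shows "chain_length (map (linepath a b) ts) = (if ts = [] then 0 else (last ts - hd ts) * dist a b)"
  using assms
proof (induction ts rule: rev_induct)
  case Nil
  then show ?case
    by (simp add: chain_length_def)
next
  case (snoc t ts)
  show ?case
  proof (cases "ts = []")
    case True
    then show ?thesis
      by (simp add: chain_length_single)
  next
    case False
    then have "last ts \<le> t"
      using snoc.prems by (simp add: sorted_append)
    moreover have "linepath a b (last ts) - linepath a b t = (last ts - t) *\<^sub>R (b - a)"
      by (simp add: linepath_def algebra_simps)
    ultimately have "dist (linepath a b (last ts)) (linepath a b t) = (t - last ts) * dist a b"
      by (simp add: dist_norm norm_minus_commute)
    then show ?thesis
      using False snoc by (simp add: chain_length_snoc last_map sorted_append algebra_simps)
  qed
qed

lemma path_length_linepath: "path_length (linepath a b) \<le> ennreal (dist a b)"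
  unfolding path_length_def
proof (rule SUP_least)
  fix ts :: "real list"
  assume "ts \<in> {ts. sorted ts \<and> set ts \<subseteq> {0..1}}"
  then have ts: "sorted ts" "set ts \<subseteq> {0..1}"
    by auto
  have "chain_length (map (linepath a b) ts) \<le> dist a b"
  proof (cases "ts = []")
    case False
    then have "hd ts \<in> {0..1}" "last ts \<in> {0..1}"
      using ts by (auto dest!: subsetD)
    then have "(last ts - hd ts) * dist a b \<le> 1 * dist a b"
      by (intro mult_right_mono) auto
    then show ?thesis
      using False ts by (simp add: chain_length_linepath)
  qed (simp add: chain_length_def)
  then show "ennreal (chain_length (map (linepath a b) ts)) \<le> ennreal (dist a b)"
    by (rule ennreal_leI)
qed

lemma terrain_dist_le_dist:
  assumes "closed_segment p q \<subseteq> region T"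
  shows "terrain_dist T p q \<le> ennreal (dist p q)"
  unfolding terrain_dist_def
  using assms path_length_linepath by (intro INF_lower2[of "linepath p q"]) auto

text \<open>The chain formed by the two end points is inscribed in every path. This makes the
  distance of different starting points positive.\<close>

lemma dist_le_terrain_dist: "ennreal (dist p q) \<le> terrain_dist T p q"
  unfolding terrain_dist_def
proof (rule INF_greatest)
  fix g
  assume "g \<in> {g. path g \<and> path_image g \<subseteq> region T \<and> pathstart g = p \<and> pathfinish g = q}"
  then have "chain_length (map g [0, 1]) = dist p q"
    by (simp add: chain_length_def pathstart_def pathfinish_def)
  then show "ennreal (dist p q) \<le> path_length g"
    unfolding path_length_def by (intro SUP_upper2[of "[0, 1]"]) auto
qed


subsection \<open>Meetings\<close>

text \<open>The rendezvous guarantee yields some meeting, but costs are taken at a first one. It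
  exists because the meeting times of continuous walks form a closed set bounded below.\<close>

lemma first_meeting_exists:
  assumes "continuous_on {0..} f" "continuous_on {0..} g" "0 \<le> t" "f t = g t"
  shows "\<exists>t'. first_meeting f g t'"
proof -
  define S where "S = {t \<in> {0..}. f t - g t = 0}"
  have "closed S"
    unfolding S_def using assms
    by (intro continuous_closed_preimage_constant continuous_on_diff closed_atLeast)
  moreover have "t \<in> S" "bdd_below S"
    using assms by (auto simp: S_def intro!: bdd_belowI[of _ 0])
  ultimately have "Inf S \<in> S" "\<And>t'. t' \<in> S \<Longrightarrow> Inf S \<le> t'"
    by (auto intro: closed_contains_Inf cInf_lower)
  then show ?thesis
    by (force simp: first_meeting_def S_def)
qed

lemma rendezvous_algorithm_route:
  assumes "rendezvous_algorithm A" "terrain T" "0 < \<mu>" "s \<in> region T" "0 < r"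
  shows "\<exists>ps. is_route A \<mu> T s r \<omega> ps"
  using assms unfolding rendezvous_algorithm_def by blast

lemma rendezvous_algorithm_meet:
  assumes A: "rendezvous_algorithm A"
    and "terrain T" "0 < \<mu>\<^sub>1" "0 < \<mu>\<^sub>2" "\<mu>\<^sub>1 \<noteq> \<mu>\<^sub>2" "s\<^sub>1 \<in> region T" "s\<^sub>2 \<in> region T" "s\<^sub>1 \<noteq> s\<^sub>2"
      "0 < r\<^sub>1" "0 < r\<^sub>2" "is_route A \<mu>\<^sub>1 T s\<^sub>1 r\<^sub>1 \<omega>\<^sub>1 ps\<^sub>1" "is_walk ps\<^sub>1 ts\<^sub>1 f\<^sub>1"
      "is_route A \<mu>\<^sub>2 T s\<^sub>2 r\<^sub>2 \<omega>\<^sub>2 ps\<^sub>2" "is_walk ps\<^sub>2 ts\<^sub>2 f\<^sub>2"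
  shows "\<exists>t\<ge>0. f\<^sub>1 t = f\<^sub>2 t"
  by (rule A[unfolded rendezvous_algorithm_def, THEN conjunct2, rule_format, of T \<mu>\<^sub>1 \<mu>\<^sub>2 s\<^sub>1 s\<^sub>2 r\<^sub>1 r\<^sub>2
        \<omega>\<^sub>1 ps\<^sub>1 ts\<^sub>1 f\<^sub>1 \<omega>\<^sub>2 ps\<^sub>2 ts\<^sub>2 f\<^sub>2]) (use assms in simp)

section \<open>Forcing an agent to traverse its whole route\<close>

lemma negligible_trace: "negligible (trace ps)"
proof -
  have "negligible (closed_segment a b)" for a b :: complex
  proof -
    have "interior (closed_segment a b) = {}"
      by (intro interior_closed_segment_ge2) simp
    then show ?thesis
      by (simp add: negligible_convex_interior)
  qed
  then show ?thesis
    unfolding trace_def 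
    by (intro negligible_Un negligible_finite[OF finite_set] negligible_Union) auto
qed

lemma compact_trace: "compact (trace ps)"
  unfolding trace_def by (intro compact_Un compact_UN finite_imp_compact[OF finite_set]) auto

text \<open>The start of the second agent has a positive distance from the compact first route.
  Slowed down enough, that agent stays within this distance of its start until the first agent has
  finished, so they cannot meet earlier.\<close>

lemma whole_route_cost:
  assumes "rendezvous_algorithm A" "terrain T" "0 < \<mu>\<^sub>1" "0 < \<mu>\<^sub>2" "\<mu>\<^sub>1 \<noteq> \<mu>\<^sub>2"
    and "s\<^sub>1 \<in> region T" "s\<^sub>2 \<in> region T" "is_route A \<mu>\<^sub>1 T s\<^sub>1 1 0 ps\<^sub>1" "s\<^sub>2 \<notin> trace ps\<^sub>1"
  shows "\<exists>C \<in> possible_costs A T \<mu>\<^sub>1 \<mu>\<^sub>2 s\<^sub>1 s\<^sub>2. chain_length ps\<^sub>1 \<le> C"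
proof -
  obtain n where ps\<^sub>1: "ps\<^sub>1 = run A \<mu>\<^sub>1 T s\<^sub>1 1 0 n"
    using assms(8) by (auto simp: is_route_def)
  have "hd ps\<^sub>1 \<in> trace ps\<^sub>1"
    unfolding ps\<^sub>1 trace_def by (simp add: run_nonempty)
  then have "s\<^sub>1 \<in> trace ps\<^sub>1"
    by (simp add: ps\<^sub>1 hd_run)
  then have "s\<^sub>1 \<noteq> s\<^sub>2"
    using assms(9) by auto
  obtain ps\<^sub>2 where ps\<^sub>2: "is_route A \<mu>\<^sub>2 T s\<^sub>2 1 0 ps\<^sub>2"
    using rendezvous_algorithm_route[OF assms(1,2,4,7) zero_less_one] by blast
  then have hd: "hd ps\<^sub>2 = s\<^sub>2" "ps\<^sub>2 \<noteq> []"
    by (auto simp: is_route_def hd_run run_nonempty)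
  obtain ts\<^sub>1 f\<^sub>1 where w\<^sub>1: "is_walk ps\<^sub>1 ts\<^sub>1 f\<^sub>1" and lip\<^sub>1: "1-lipschitz_on {0..} f\<^sub>1"
    and tr: "f\<^sub>1 ` {0..} \<subseteq> trace ps\<^sub>1" and T\<^sub>1: "0 \<le> last ts\<^sub>1"
    using lipschitz_walk_exists[of ps\<^sub>1 1] ps\<^sub>1 run_nonempty by auto
  obtain ts\<^sub>2 f\<^sub>2 where w\<^sub>2: "is_walk ps\<^sub>2 ts\<^sub>2 f\<^sub>2" and lip\<^sub>2: "1-lipschitz_on {0..} f\<^sub>2"
    using lipschitz_walk_exists[of ps\<^sub>2 1] hd by auto
  obtain \<eta> where \<eta>: "0 < \<eta>" "\<And>z. z \<in> trace ps\<^sub>1 \<Longrightarrow> \<eta> \<le> dist s\<^sub>2 z"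
    using separate_point_closed[OF compact_imp_closed[OF compact_trace] assms(9)] by auto
  \<comment> \<open>Up to time \<open>last ts\<^sub>1\<close> the slowed agent moves by at most
    \<open>k * last ts\<^sub>1\<close>, which this choice makes smaller than \<open>\<eta>\<close>.
    The added 1 keeps the denominator positive when the first route is a single point and
    \<open>last ts\<^sub>1 = 0\<close>.\<close>
  define k where "k = \<eta> / (2 * (last ts\<^sub>1 + 1))"
  define g where "g t = f\<^sub>2 (k * t)" for t
  have k: "0 < k" "k * last ts\<^sub>1 < \<eta>"
    using \<eta> T\<^sub>1 by (auto simp: k_def field_simps add_pos_nonneg add_nonneg_pos)
  have w: "is_walk ps\<^sub>2 (map (\<lambda>t. t / k) ts\<^sub>2) g"
    unfolding g_def using w\<^sub>2 k(1) by (rule is_walk_slowdown)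
  have no_early: "f\<^sub>1 t \<noteq> g t" if "0 \<le> t" "t \<le> last ts\<^sub>1" for t
  proof -
    have "dist (f\<^sub>2 0) (f\<^sub>2 (k * t)) \<le> 1 * dist 0 (k * t)"
      using that k by (intro lipschitz_onD[OF lip\<^sub>2]) auto
    also have "\<dots> \<le> k * last ts\<^sub>1"
      using that k by (simp add: dist_real_def)
    finally have "dist s\<^sub>2 (g t) < \<eta>"
      using k is_walk_start[OF w\<^sub>2] hd by (simp add: g_def)
    moreover have "\<eta> \<le> dist s\<^sub>2 (f\<^sub>1 t)"
      using tr that by (intro \<eta>) auto
    ultimately show ?thesis by auto
  qed
  have "\<exists>t\<ge>0. f\<^sub>1 t = g t"
    by (rule rendezvous_algorithm_meet[OF assms(1-7) \<open>s\<^sub>1 \<noteq> s\<^sub>2\<close> zero_less_one zero_less_one assms(8) w\<^sub>1 ps\<^sub>2 w])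
  moreover have "continuous_on {0..} g"
    unfolding g_def using k
    by (intro continuous_on_compose2[OF lipschitz_on_continuous_on[OF lip\<^sub>2]] continuous_intros) auto
  ultimately obtain t where t: "first_meeting f\<^sub>1 g t"
    using first_meeting_exists lipschitz_on_continuous_on[OF lip\<^sub>1] by blast
  then have "last ts\<^sub>1 \<le> t"
    using no_early by (force simp: first_meeting_def)
  then have "chain_length ps\<^sub>1 = trajectory_length ps\<^sub>1 ts\<^sub>1 f\<^sub>1 t"
    using trajectory_length_complete[OF w\<^sub>1] by simp
  also have "\<dots> \<le> \<dots> + trajectory_length ps\<^sub>2 (map (\<lambda>t. t / k) ts\<^sub>2) g t"
    using trajectory_length_nonneg by simp
  finally have "chain_length ps\<^sub>1 \<le>
    trajectory_length ps\<^sub>1 ts\<^sub>1 f\<^sub>1 t + trajectory_length ps\<^sub>2 (map (\<lambda>t. t / k) ts\<^sub>2) g t" .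
  moreover have "trajectory_length ps\<^sub>1 ts\<^sub>1 f\<^sub>1 t + trajectory_length ps\<^sub>2 (map (\<lambda>t. t / k) ts\<^sub>2) g t
      \<in> possible_costs A T \<mu>\<^sub>1 \<mu>\<^sub>2 s\<^sub>1 s\<^sub>2"
    unfolding possible_costs_def mem_Collect_eq
    by (intro exI conjI, rule refl) (rule zero_less_one assms(8) w\<^sub>1 ps\<^sub>2 w t)+
  ultimately show ?thesis by blast
qed


subsection \<open>Some label has a long route\<close>

text \<open>The axis direction of the coordinate of larger absolute value, as a unit complex number:
  \<open>Re (cnj (heading z) * z)\<close> is the maximum norm of \<open>z\<close>, which is at least
  1 outside the open inner square.\<close>

definition heading :: "complex \<Rightarrow> complex" where
  "heading z =
     (if \<bar>Im z\<bar> \<le> \<bar>Re z\<bar> then (if 0 \<le> Re z then 1 else - 1) else (if 0 \<le> Im z then \<i> else - \<i>))"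

lemma heading_in: "heading z \<in> {1, - 1, \<i>, - \<i>}"
  by (simp add: heading_def)

lemma Re_cnj_heading:
  assumes "1 \<le> \<bar>Re z\<bar> \<or> 1 \<le> \<bar>Im z\<bar>"
  shows "1 \<le> Re (cnj (heading z) * z)"
  using assms by (auto simp: heading_def)

lemma same_half_plane_not_antipodal:
  assumes "0 < Re (u * z)" "0 < Re (u * w)"
  shows "z \<noteq> - w"
proof
  assume "z = - w"
  then have "Re (u * z) = - Re (u * w)" by simp
  then show False using assms by linarith
qed

text \<open>Multiplication by a unit number followed by the real part is 1-Lipschitz; its value at
  \<open>z\<close> is at least 1, so it remains positive at distance less than 1.\<close>

lemma Re_cnj_heading_near:
  assumes "1 \<le> \<bar>Re z\<bar> \<or> 1 \<le> \<bar>Im z\<bar>" "dist z w < 1"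
  shows "0 < Re (cnj (heading z) * w)"
proof -
  have "cmod (cnj (heading z)) = 1"
    using heading_in[of z] by auto
  then have "\<bar>Re (cnj (heading z) * (z - w))\<bar> \<le> dist z w"
    using abs_Re_le_cmod[of "cnj (heading z) * (z - w)"] by (simp add: norm_mult dist_norm)
  moreover have "Re (cnj (heading z) * (z - w)) = Re (cnj (heading z) * z) - Re (cnj (heading z) * w)"
    by (simp add: algebra_simps)
  ultimately show ?thesis
    using Re_cnj_heading[OF assms(1)] assms(2) by linarith
qed

lemma same_headings_not_antipodal:
  fixes f g :: "real \<Rightarrow> complex"
  assumes lip: "1-lipschitz_on {0..} f" "1-lipschitz_on {0..} g"
    and out: "\<And>t. 0 \<le> t \<Longrightarrow> 1 \<le> \<bar>Re (f t)\<bar> \<or> 1 \<le> \<bar>Im (f t)\<bar>"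
      "\<And>t. 0 \<le> t \<Longrightarrow> 1 \<le> \<bar>Re (g t)\<bar> \<or> 1 \<le> \<bar>Im (g t)\<bar>"
    and inert: "\<And>t. real n \<le> t \<Longrightarrow> f t = f (real n)" "\<And>t. real n \<le> t \<Longrightarrow> g t = g (real n)"
    and eq: "\<And>j. j \<le> 2 * n \<Longrightarrow> heading (f (real j / 2)) = heading (g (real j / 2))"
    and t: "0 \<le> t"
  shows "f t \<noteq> - g t"
proof -
  \<comment> \<open>Both agents are inert after time \<open>n\<close>, so the comparison can be made
    at a time up to \<open>n\<close>; hence finitely many records suffice.\<close>
  define t' where "t' = min t (real n)"
  \<comment> \<open>The last recorded time up to \<open>t'\<close> is \<open>real j / 2\<close>. It
    is less than 1/2 earlier, so neither agent has since moved by 1.\<close>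
  define j where "j = nat \<lfloor>2 * t'\<rfloor>"
  have t': "0 \<le> t'" "f t = f t'" "g t = g t'"
    using t inert[of t] by (auto simp: t'_def min_def)
  then have j: "real j \<le> 2 * t'" "2 * t' < real j + 1"
    by (auto simp: j_def)
  have "2 * t' \<le> real (2 * n)"
    by (simp add: t'_def)
  then have "j \<le> 2 * n"
    using j by linarith
  have near: "dist (h (real j / 2)) (h t') < 1" if "1-lipschitz_on {0..} h" for h :: "real \<Rightarrow> complex"
  proof -
    have "dist (h (real j / 2)) (h t') \<le> 1 * dist (real j / 2) t'"
      using that t' by (intro lipschitz_onD) auto
    also have "\<dots> < 1"
      using j by (simp add: dist_real_def)
    finally show ?thesis .
  qed
  have "f t' \<noteq> - g t'"
  proof (rule same_half_plane_not_antipodal)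
    show "0 < Re (cnj (heading (f (real j / 2))) * f t')"
      using out near lip by (intro Re_cnj_heading_near) auto
    show "0 < Re (cnj (heading (f (real j / 2))) * g t')"
      unfolding eq[OF \<open>j \<le> 2 * n\<close>] using out near lip by (intro Re_cnj_heading_near) auto
  qed
  then show ?thesis
    by (simp add: t')
qed

section \<open>Counting the records of short routes\<close>

lemma trace_route_annulus:
  assumes "2 \<le> R" "s \<in> region (annulus R)" "is_route A \<mu> (annulus R) s r \<omega> ps"
  shows "trace ps \<subseteq> region (annulus R)"
  using assms(3) trace_run[OF closed_region_annulus[OF assms(1)] boundary_segments_annulus[OF assms(1)] assms(2)]
  by (fastforce simp: is_route_def)

lemma long_route_exists:
  assumes R: "2 \<le> R" and A: "rendezvous_algorithm A" and s: "s \<in> region (annulus R)" and q: "2 \<le> q"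
  shows "\<exists>\<mu> \<in> {2 ^ (8 * q - 1)..<2 ^ (8 * q)}. \<exists>ps.
    is_route A \<mu> (annulus R) s 1 0 ps \<and> real q \<le> chain_length ps"
proof (rule ccontr)
  define T where "T = annulus R"
  \<comment> \<open>The labels of length \<open>8 * q\<close>; there are
    \<open>2 ^ (8 * q - 1)\<close> of them.\<close>
  define M :: "nat set" where "M = {2 ^ (8 * q - 1)..<2 ^ (8 * q)}"
  assume "\<not> ?thesis"
  then have short: "chain_length ps < real q" if "\<mu> \<in> M" "is_route A \<mu> T s 1 0 ps" for \<mu> ps
    using that by (force simp: M_def T_def)
  have M_pos: "0 < \<mu>" if "\<mu> \<in> M" for \<mu>
    using that by (auto simp: M_def intro: less_le_trans[of 0 "2 ^ (8 * q - 1)"])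
  \<comment> \<open>A route shorter than \<open>q\<close>, walked with extra time 1, is finished by
    time \<open>q + 1\<close>.\<close>
  have "\<forall>\<mu> \<in> M. \<exists>ps ts f. is_route A \<mu> T s 1 0 ps \<and> is_walk ps ts f \<and> 1-lipschitz_on {0..} f \<and>
      f ` {0..} \<subseteq> region T \<and> last ts \<le> real (q + 1)"
  proof
    fix \<mu> assume \<mu>: "\<mu> \<in> M"
    then obtain ps where ps: "is_route A \<mu> T s 1 0 ps"
      using rendezvous_algorithm_route[OF A terrain_annulus[OF R] M_pos s zero_less_one]
      unfolding T_def by blast
    then have "ps \<noteq> []"
      by (auto simp: is_route_def run_nonempty)
    then obtain ts f where f: "is_walk ps ts f" "1-lipschitz_on {0..} f" "f ` {0..} \<subseteq> trace ps"
      "last ts \<le> chain_length ps + 1"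
      using lipschitz_walk_exists[of ps 1] by auto
    moreover have "trace ps \<subseteq> region T"
      using R s ps unfolding T_def by (rule trace_route_annulus)
    ultimately show "\<exists>ps ts f. is_route A \<mu> T s 1 0 ps \<and> is_walk ps ts f \<and> 1-lipschitz_on {0..} f \<and>
      f ` {0..} \<subseteq> region T \<and> last ts \<le> real (q + 1)"
      using ps short[OF \<mu> ps] by (intro exI[of _ ps] exI[of _ ts] exI[of _ f]) auto
  qed
  then obtain P ts F where route: "\<And>\<mu>. \<mu> \<in> M \<Longrightarrow> is_route A \<mu> T s 1 0 (P \<mu>)"
    and walk: "\<And>\<mu>. \<mu> \<in> M \<Longrightarrow> is_walk (P \<mu>) (ts \<mu>) (F \<mu>)"
    and lip: "\<And>\<mu>. \<mu> \<in> M \<Longrightarrow> 1-lipschitz_on {0..} (F \<mu>)"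
    and reg: "\<And>\<mu>. \<mu> \<in> M \<Longrightarrow> F \<mu> ` {0..} \<subseteq> region T"
    and last: "\<And>\<mu>. \<mu> \<in> M \<Longrightarrow> last (ts \<mu>) \<le> real (q + 1)"
    by metis
  \<comment> \<open>The recorded times are 0, 1/2, ..., \<open>q + 1\<close>, with both ends
    included: indices 0 to \<open>2 * (q + 1)\<close>, hence \<open>2 * q + 3\<close>
    entries.\<close>
  define code where "code \<mu> = map (\<lambda>j. heading (F \<mu> (real j / 2))) [0..<2 * q + 3]" for \<mu>
  define H where "H = {1, - 1, \<i>, - \<i>}"
  have "card (code ` M) < card M"
  proof -
    have "heading z \<in> H" for z
      unfolding H_def by (rule heading_in)
    then have "code ` M \<subseteq> {xs. set xs \<subseteq> H \<and> length xs = 2 * q + 3}"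
      by (auto simp: code_def)
    then have "card (code ` M) \<le> card {xs. set xs \<subseteq> H \<and> length xs = 2 * q + 3}"
      by (intro card_mono finite_lists_length_eq) (simp_all add: H_def)
    also have "\<dots> = card H ^ (2 * q + 3)"
      by (intro card_lists_length_eq) (simp add: H_def)
    also have "\<dots> \<le> 4 ^ (2 * q + 3)"
      by (intro power_mono) (simp_all add: H_def card_insert_if)
    also have "\<dots> = 2 ^ (2 * (2 * q + 3))"
      by (simp only: power_mult) simp
    \<comment> \<open>The exponents satisfy \<open>4 * q + 6 < 8 * q - 1\<close> because
      \<open>q\<close> is at least 2. The factor 8 in the label length is chosen to leave this
      room.\<close>
    also have "\<dots> < 2 ^ (8 * q - 1)"
      using q by (intro power_strict_increasing) auto
    also have "\<dots> = card M"
    proof -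
      obtain k where "8 * q = Suc k"
        using q by (cases "8 * q") auto
      then show ?thesis
        by (simp add: M_def)
    qed
    finally show ?thesis .
  qed
  then obtain \<mu> \<nu> where \<mu>\<nu>: "\<mu> \<in> M" "\<nu> \<in> M" "\<mu> \<noteq> \<nu>" "code \<mu> = code \<nu>"
    using pigeonhole unfolding inj_on_def by blast
  have "F \<mu> t \<noteq> - F \<nu> t" if "0 \<le> t" for t
  proof (rule same_headings_not_antipodal[OF lip[OF \<mu>\<nu>(1)] lip[OF \<mu>\<nu>(2)], of "q + 1"])
    have out: "1 \<le> \<bar>Re (F \<kappa> t)\<bar> \<or> 1 \<le> \<bar>Im (F \<kappa> t)\<bar>" if "\<kappa> \<in> M" "0 \<le> t" for \<kappa> t
    proof -
      have "F \<kappa> t \<in> region T"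
        using reg that by auto
      then show ?thesis
        by (simp add: T_def region_annulus[OF R])
    qed
    show "1 \<le> \<bar>Re (F \<mu> t)\<bar> \<or> 1 \<le> \<bar>Im (F \<mu> t)\<bar>" "1 \<le> \<bar>Re (F \<nu> t)\<bar> \<or> 1 \<le> \<bar>Im (F \<nu> t)\<bar>" if "0 \<le> t" for t
      using out \<mu>\<nu> that by auto
    have "F \<kappa> t = List.last (P \<kappa>)" if "\<kappa> \<in> M" "real (q + 1) \<le> t" for \<kappa> t
      using walk[OF that(1)] last[OF that(1)] that(2) by (auto simp: is_walk_def)
    then show "F \<mu> t = F \<mu> (real (q + 1))" "F \<nu> t = F \<nu> (real (q + 1))" if "real (q + 1) \<le> t" for t
      using \<mu>\<nu> that by simp_all
    show "heading (F \<mu> (real j / 2)) = heading (F \<nu> (real j / 2))" if "j \<le> 2 * (q + 1)" for j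
      using \<mu>\<nu>(4) that by (auto simp: code_def dest: bspec[of _ _ j])
  qed (use that in simp)
  \<comment> \<open>The agent with label \<open>\<nu>\<close> is started at \<open>- s\<close> with
    North turned by \<open>pi\<close> and performs the reflected walk, so the guarantee for
    \<open>A\<close> forces the meeting just excluded.\<close>
  moreover have "\<exists>t\<ge>0. F \<mu> t = - F \<nu> t"
  proof (rule rendezvous_algorithm_meet[OF A])
    show "terrain T"
      unfolding T_def by (rule terrain_annulus[OF R])
    \<comment> \<open>The antipodal start differs from \<open>s\<close> because the centre lies in
      the obstacle.\<close>
    show "s \<in> region T" "- s \<in> region T" "s \<noteq> - s"
      using s by (auto simp: T_def region_annulus[OF R] complex_eq_iff)
    show "is_route A \<nu> T (- s) 1 (0 + pi) (map uminus (P \<nu>))"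
      using centrally_symmetric_annulus[OF R] route[OF \<mu>\<nu>(2)] unfolding T_def by (rule is_route_uminus)
    show "is_walk (map uminus (P \<nu>)) (ts \<nu>) (\<lambda>t. - F \<nu> t)"
      using walk[OF \<mu>\<nu>(2)] by (rule is_walk_uminus)
  qed (use \<mu>\<nu> M_pos route walk in auto)
  ultimately show False by blast
qed


subsection \<open>The lower bound\<close>

lemma label_length_eq:
  assumes "\<mu> \<in> {2 ^ (k - 1)..<2 ^ k}" "0 < k"
  shows "label_length \<mu> = k"
proof -
  obtain n where n: "k = Suc n"
    using assms(2) by (cases k) auto
  have "real (2 ^ n) \<le> real \<mu>" "real \<mu> < real (2 ^ (n + 1))"
    using assms(1) unfolding n of_nat_le_iff of_nat_less_iff by auto
  then have "\<lfloor>log 2 (real \<mu>)\<rfloor> = int n"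
    using assms by (subst floor_log_eq_powr_iff) (auto simp: powr_realpow powr_add n)
  then show ?thesis
    by (simp add: label_length_def n)
qed

text \<open>A small disc about 3/2 is not negligible, so it contains a point \<open>z\<close> off
  the trace. The disc is convex and lies in the region, so the terrain distance to \<open>z\<close>
  is at most the Euclidean one; it is positive since 3/2 is on the trace and \<open>z\<close> is
  not.\<close>

lemma close_start_exists:
  assumes "2 \<le> R" "0 < \<epsilon>" "3 / 2 \<in> trace ps"
  obtains z where "z \<in> region (annulus R)" "z \<notin> trace ps"
    "0 < terrain_dist (annulus R) (3 / 2) z" "terrain_dist (annulus R) (3 / 2) z \<le> ennreal \<epsilon>"
proof -
  \<comment> \<open>Radius at most 1/2 keeps the real part between 1 and 2, outside the obstacle and
    inside the outer square.\<close>
  define B where "B = ball (3 / 2 :: complex) (min \<epsilon> (1 / 2))"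
  have "\<not> negligible B"
    using assms(2) by (intro open_not_negligible) (auto simp: B_def)
  then obtain z where z: "z \<in> B" "z \<notin> trace ps"
    using negligible_subset[OF negligible_trace] by blast
  have "B \<subseteq> region (annulus R)"
  proof
    fix w assume "w \<in> B"
    then have "cmod (3 / 2 - w) < 1 / 2"
      by (simp add: B_def dist_norm)
    then have "\<bar>Re (3 / 2 - w)\<bar> < 1 / 2" "\<bar>Im (3 / 2 - w)\<bar> < 1 / 2"
      using abs_Re_le_cmod abs_Im_le_cmod le_less_trans by blast+
    then show "w \<in> region (annulus R)"
      using assms(1) by (auto simp: region_annulus abs_if split: if_splits)
  qed
  moreover have "closed_segment (3 / 2) z \<subseteq> B"
    using z(1) assms(2) unfolding B_def by (intro closed_segment_subset) auto
  ultimately have "terrain_dist (annulus R) (3 / 2) z \<le> ennreal (dist (3 / 2) z)"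
    by (intro terrain_dist_le_dist) auto
  also have "\<dots> \<le> ennreal \<epsilon>"
    using z(1) by (intro ennreal_leI) (simp add: B_def)
  finally have "terrain_dist (annulus R) (3 / 2) z \<le> ennreal \<epsilon>" .
  moreover have "3 / 2 \<noteq> z"
    using assms(3) z(2) by blast
  then have "0 < ennreal (dist (3 / 2) z)"
    by simp
  then have "0 < terrain_dist (annulus R) (3 / 2) z"
    using dist_le_terrain_dist by (rule less_le_trans)
  ultimately show thesis
    using that z \<open>B \<subseteq> region (annulus R)\<close> by blast
qed

theorem theorem3p5:
  shows "\<exists>c::real. 0 < c \<and>
    (\<forall>N::real. 0 < N \<longrightarrow>
      (\<exists>T. terrain T \<and> obstacles T \<noteq> [] \<and> N \<le> total_perimeter T \<and>
        (\<forall>A. rendezvous_algorithm A \<longrightarrow>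
          (\<forall>(m::nat) (\<epsilon>::real). 1 \<le> m \<and> 0 < \<epsilon> \<longrightarrow>
            (\<exists>\<mu>\<^sub>1 \<mu>\<^sub>2 L s\<^sub>1 s\<^sub>2.
              0 < \<mu>\<^sub>1 \<and> 0 < \<mu>\<^sub>2 \<and> \<mu>\<^sub>1 \<noteq> \<mu>\<^sub>2 \<and> L = max \<mu>\<^sub>1 \<mu>\<^sub>2 \<and> m \<le> label_length L \<and>
              s\<^sub>1 \<in> region T \<and> s\<^sub>2 \<in> region T \<and>
              0 < terrain_dist T s\<^sub>1 s\<^sub>2 \<and> terrain_dist T s\<^sub>1 s\<^sub>2 \<le> ennreal \<epsilon> \<and>
              (\<exists>C \<in> possible_costs A T \<mu>\<^sub>1 \<mu>\<^sub>2 s\<^sub>1 s\<^sub>2.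
                c * (total_perimeter T +
                     largest_obstacle_perimeter T * real (label_length L)) \<le> C))))))"
\<comment> \<open>For labels of length \<open>8 * q\<close> with \<open>R + 1 \<le> q\<close>, the
  perimeter \<open>8 * R + 8\<close> is at most \<open>8 * q\<close> and the obstacle term is
  \<open>8 * (8 * q)\<close>. The sum is at most \<open>72 * q\<close>, while the cost is at least
  \<open>q\<close>.\<close>
proof (intro exI[of _ "1 / 72"] conjI allI impI)
  fix N :: real
  \<comment> \<open>The terrain depends on \<open>N\<close> alone; the label length is chosen later,
    when \<open>m\<close> is known, and may be as large as the perimeter requires.\<close>
  define R where "R = max 2 N"
  have R: "2 \<le> R"
    by (simp add: R_def)
  have per: "total_perimeter (annulus R) = 8 * R + 8" "largest_obstacle_perimeter (annulus R) = 8"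
    using R by (auto simp: total_perimeter_annulus largest_obstacle_perimeter_annulus)
  have lower: "\<exists>\<mu>\<^sub>1 \<mu>\<^sub>2 L s\<^sub>1 s\<^sub>2.
      0 < \<mu>\<^sub>1 \<and> 0 < \<mu>\<^sub>2 \<and> \<mu>\<^sub>1 \<noteq> \<mu>\<^sub>2 \<and> L = max \<mu>\<^sub>1 \<mu>\<^sub>2 \<and> m \<le> label_length L \<and>
      s\<^sub>1 \<in> region (annulus R) \<and> s\<^sub>2 \<in> region (annulus R) \<and>
      0 < terrain_dist (annulus R) s\<^sub>1 s\<^sub>2 \<and> terrain_dist (annulus R) s\<^sub>1 s\<^sub>2 \<le> ennreal \<epsilon> \<and>
      (\<exists>C \<in> possible_costs A (annulus R) \<mu>\<^sub>1 \<mu>\<^sub>2 s\<^sub>1 s\<^sub>2.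
        1 / 72 * (total_perimeter (annulus R) +
          largest_obstacle_perimeter (annulus R) * real (label_length L)) \<le> C)"
    if A: "rendezvous_algorithm A" and m\<epsilon>: "1 \<le> m \<and> 0 < \<epsilon>" for A and m :: nat and \<epsilon> :: real
  proof -
    \<comment> \<open>The bound \<open>R + 1\<close> lets the route length absorb the perimeter, and
      \<open>m\<close> makes the labels long enough.\<close>
    define q where "q = max m (nat \<lceil>R + 1\<rceil>)"
    have q: "R + 1 \<le> real q" "m \<le> 8 * q"
      by (auto simp: q_def max_def) linarith+
    then have "2 \<le> q"
      using R by linarith
    have s: "3 / 2 \<in> region (annulus R)"
      using R by (simp add: region_annulus)
    obtain \<mu> ps where \<mu>: "\<mu> \<in> {2 ^ (8 * q - 1)..<2 ^ (8 * q)}"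
      and ps: "is_route A \<mu> (annulus R) (3 / 2) 1 0 ps" "real q \<le> chain_length ps"
      using long_route_exists[OF R A s \<open>2 \<le> q\<close>] by blast
    \<comment> \<open>Any other label of length \<open>8 * q\<close> serves for the second agent:
      whichever of the two is larger, its length is known.\<close>
    define \<nu> :: nat where "\<nu> = (if \<mu> = 2 ^ (8 * q - 1) then 2 ^ (8 * q - 1) + 1 else 2 ^ (8 * q - 1))"
    have "(2 :: nat) ^ (8 * q - 1) + 1 < 2 ^ (8 * q)"
    proof -
      have "8 * q = Suc (8 * q - 1)"
        using \<open>2 \<le> q\<close> by linarith
      then have "(2 :: nat) ^ (8 * q) = 2 ^ (8 * q - 1) + 2 ^ (8 * q - 1)"
        by (metis mult_2 power_Suc)
      moreover have "(1 :: nat) < 2 ^ (8 * q - 1)"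
        using \<open>2 \<le> q\<close> by (intro one_less_power) auto
      ultimately show ?thesis by linarith
    qed
    then have \<nu>: "\<nu> \<in> {2 ^ (8 * q - 1)..<2 ^ (8 * q)}" "\<mu> \<noteq> \<nu>"
      using \<open>2 \<le> q\<close> by (auto simp: \<nu>_def)
    have pos: "0 < \<mu>" "0 < \<nu>"
      using \<mu> \<nu> by (auto intro: less_le_trans[of 0 "2 ^ (8 * q - 1)"])
    have len: "label_length (max \<mu> \<nu>) = 8 * q"
      using \<mu> \<nu> \<open>2 \<le> q\<close> by (intro label_length_eq) (auto simp: max_def)
    have "3 / 2 \<in> trace ps"
    proof -
      have "hd ps = 3 / 2" "ps \<noteq> []"
        using ps(1) by (auto simp: is_route_def hd_run run_nonempty)
      then show ?thesis
        unfolding trace_def by (metis UnI1 hd_in_set)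
    qed
    then obtain z where z: "z \<in> region (annulus R)" "z \<notin> trace ps"
      "0 < terrain_dist (annulus R) (3 / 2) z" "terrain_dist (annulus R) (3 / 2) z \<le> ennreal \<epsilon>"
      using close_start_exists[OF R, of \<epsilon> ps] m\<epsilon> by blast
    obtain C where C: "C \<in> possible_costs A (annulus R) \<mu> \<nu> (3 / 2) z" "chain_length ps \<le> C"
      using whole_route_cost[OF A terrain_annulus[OF R] pos \<nu>(2) s z(1) ps(1) z(2)] by blast
    have "1 / 72 * (total_perimeter (annulus R) +
        largest_obstacle_perimeter (annulus R) * real (label_length (max \<mu> \<nu>))) \<le> C"
      using C(2) ps(2) q(1) by (simp add: per len)
    then show ?thesis
      using pos \<nu>(2) len q(2) s z C(1)
      by (intro exI[of _ \<mu>] exI[of _ \<nu>] exI[of _ "max \<mu> \<nu>"] exI[of _ "3 / 2"] exI[of _ z] conjI) auto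
  qed
  show "\<exists>T. terrain T \<and> obstacles T \<noteq> [] \<and> N \<le> total_perimeter T \<and>
        (\<forall>A. rendezvous_algorithm A \<longrightarrow>
          (\<forall>(m::nat) (\<epsilon>::real). 1 \<le> m \<and> 0 < \<epsilon> \<longrightarrow>
            (\<exists>\<mu>\<^sub>1 \<mu>\<^sub>2 L s\<^sub>1 s\<^sub>2.
              0 < \<mu>\<^sub>1 \<and> 0 < \<mu>\<^sub>2 \<and> \<mu>\<^sub>1 \<noteq> \<mu>\<^sub>2 \<and> L = max \<mu>\<^sub>1 \<mu>\<^sub>2 \<and> m \<le> label_length L \<and>
              s\<^sub>1 \<in> region T \<and> s\<^sub>2 \<in> region T \<and>
              0 < terrain_dist T s\<^sub>1 s\<^sub>2 \<and> terrain_dist T s\<^sub>1 s\<^sub>2 \<le> ennreal \<epsilon> \<and>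
              (\<exists>C \<in> possible_costs A T \<mu>\<^sub>1 \<mu>\<^sub>2 s\<^sub>1 s\<^sub>2.
                1 / 72 * (total_perimeter T +
                     largest_obstacle_perimeter T * real (label_length L)) \<le> C))))"
  proof (intro exI[of _ "annulus R"] conjI allI impI)
    show "terrain (annulus R)"
      using R by (rule terrain_annulus)
    show "obstacles (annulus R) \<noteq> []"
      by (simp add: annulus_def)
    show "N \<le> total_perimeter (annulus R)"
      unfolding per by (simp add: R_def)
  qed (rule lower)
qed simp

end
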